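(* Let $G$ be a Polish non-locally-compact group admitting an invariant metric. Let $\mathrm{card}(\Theta)=2^{\aleph_0}$ and let $T:G\to\Theta$ be a consistent estimate of the parameter $\theta$ for a family of Borel probability measures $(\mu_\theta)_{\theta\in\Theta}$ on $G$ such that there exists $\theta_0\in\Theta$ for which $T^{-1}(\theta_0)$ is a prevalent set. Then there exists an objective consistent estimate of the parameter $\theta$ for the family $(\mu_\theta)_{\theta\in\Theta}$.
   Context: $G$ is a Polish group: a separable group with a complete invariant metric $\rho$ (i.e. $\rho(fh_1g,fh_2g)=\rho(h_1,h_2)$ for all $f,g,h_1,h_2\in G$) for which the map $(x,y)\mapsto x^{-1}y$ from $G\times G$ onto $G$ is continuous. $\mathcal{B}(G)$ is the Borel $\sigma$-algebra of $G$. A Borel set $X\subseteq G$ is shy if there is a Borel probability measure $\mu$ on $G$ with $\mu(fXg)=0$ for all $f,g\in G$; a subset of a Borel shy set is also called shy. The complement of a shy set is prevalent. A Borel set is Haar ambivalent if it is neither shy nor prevalent. $L(\Theta)$ denotes the $\sigma$-algebra on $\Theta$ generated by all singletons of $\Theta$. A $(\mathcal{B}(G),L(\Theta))$-measurable mapping $T:G\to\Theta$ is a consistent estimate of the parameter $\theta$ for $(\mu_\theta)_{\theta\in\Theta}$ if $\mu_\theta(T^{-1}(\theta))=1$ for each $\theta\in\Theta$. It is an objective consistent estimate if, in addition, $T^{-1}(\theta)$ is a Haar ambivalent set for each $\theta\in\Theta$. *)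

theory Defs
  imports "HOL-Probability.Probability" "HOL-Library.Equipollence"
begin

text \<open>
  Groups are rendered by the class \<open>group_add\<close>, which does not assume commutativity:
  \<open>f + x + g\<close> is the two-sided translate written $fxg$ in multiplicative notation, and
  \<open>- x + y\<close> is $x^{-1}y$.
\<close>

definition borel_prob_measure :: "'g::topological_space measure \<Rightarrow> bool" where
  "borel_prob_measure M \<longleftrightarrow> prob_space M \<and> sets M = sets borel"

text \<open>
  Using \<^const>\<open>null_sets\<close> instead of an equation for \<^const>\<open>emeasure\<close> excludes the convention
  that \<^const>\<open>emeasure\<close> is 0 on non-measurable sets; in a topological group the translates of a
  Borel set are Borel, so there the two agree.
\<close>

definition borel_shy :: "'g::{topological_space, group_add} set \<Rightarrow> bool" where
  "borel_shy X \<longleftrightarrow> X \<in> sets borel \<and>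
     (\<exists>M. borel_prob_measure M \<and> (\<forall>f g. (\<lambda>x. f + x + g) ` X \<in> null_sets M))"

definition shy :: "'g::{topological_space, group_add} set \<Rightarrow> bool" where
  "shy S \<longleftrightarrow> (\<exists>X. borel_shy X \<and> S \<subseteq> X)"

definition prevalent :: "'g::{topological_space, group_add} set \<Rightarrow> bool" where
  "prevalent S \<longleftrightarrow> shy (- S)"

definition haar_ambivalent :: "'g::{topological_space, group_add} set \<Rightarrow> bool" where
  "haar_ambivalent X \<longleftrightarrow> X \<in> sets borel \<and> \<not> shy X \<and> \<not> prevalent X"

definition singleton_algebra :: "'p set \<Rightarrow> 'p measure" where
  "singleton_algebra \<Theta> = sigma \<Theta> {{\<theta>} |\<theta>. \<theta> \<in> \<Theta>}"

text \<open>Measurability into \<^term>\<open>singleton_algebra \<Theta>\<close> includes that \<open>T\<close> takes its values in \<open>\<Theta>\<close>.\<close>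

definition consistent_estimate ::
    "'p set \<Rightarrow> ('p \<Rightarrow> 'g::topological_space measure) \<Rightarrow> ('g \<Rightarrow> 'p) \<Rightarrow> bool" where
  "consistent_estimate \<Theta> \<mu> T \<longleftrightarrow>
     T \<in> borel \<rightarrow>\<^sub>M singleton_algebra \<Theta> \<and>
     (\<forall>\<theta>\<in>\<Theta>. emeasure (\<mu> \<theta>) (T -` {\<theta>}) = 1)"

definition objective_consistent_estimate ::
    "'p set \<Rightarrow> ('p \<Rightarrow> 'g::{topological_space, group_add} measure) \<Rightarrow> ('g \<Rightarrow> 'p) \<Rightarrow> bool" where
  "objective_consistent_estimate \<Theta> \<mu> T \<longleftrightarrow>
     consistent_estimate \<Theta> \<mu> T \<and> (\<forall>\<theta>\<in>\<Theta>. haar_ambivalent (T -` {\<theta>}))"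

end

theory Submission
  imports Defs
begin

text \<open>
  Every fibre \<open>T\<^sup>-\<^sup>1(\<theta>)\<close> with \<open>\<theta> \<noteq> \<theta>\<^sub>0\<close> lies in the shy complement of \<open>T\<^sup>-\<^sup>1(\<theta>\<^sub>0)\<close>. The remedy is
  to give each \<open>\<theta> \<in> \<Theta>\<close> a non-shy piece of the prevalent fibre, the pieces being pairwise
  disjoint and together negligible for \<open>\<mu> \<theta>\<^sub>0\<close>. Each modified fibre then contains its own
  non-shy piece and misses a non-shy piece of another parameter, which makes it ambivalent, and no
  \<open>\<mu> \<theta>\<close> notices the change: for \<open>\<theta> \<noteq> \<theta>\<^sub>0\<close> the fibre only grows, for \<open>\<theta>\<^sub>0\<close> it loses a null set.

  The pieces come from a construction in the spirit of Solecki's theorem on Haar null sets. Since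
  the group is not locally compact, no ball is totally bounded, so at every scale there are
  infinitely many small group elements whose translates of given finite sets stay apart. Iterating
  this at scales that tend to 0 yields a tree of translates: a sequence \<open>u\<close> of naturals
  prescribes which translation is applied at each stage, a point determines the sequence to
  which it belongs (\<open>near_unique\<close>), and restricting \<open>u n\<close> to an infinite set \<open>B n\<close> for
  each \<open>n\<close> leaves room to cover a translate of any compact set
  (\<open>branch_set_catches_compact\<close>). Such a set is not shy because every Borel probability
  measure on a Polish space charges a compact set (\<open>not_shy_if_catches_compact\<close>).

  The parity of \<open>u n\<close> is a free bit at each \<open>n\<close>. The bits at even \<open>n\<close> encode a set \<open>y\<close> of
  naturals, those at odd \<open>n\<close> a set \<open>x\<close>. As \<open>y\<close> varies, the sets \<open>F y\<close> obtained by fixing the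
  bits at even \<open>n\<close> are uncountably many disjoint Borel sets, so one of them is \<open>\<mu> \<theta>\<^sub>0\<close>-null.
  Inside it the bits at odd \<open>n\<close> provide continuum many disjoint non-shy sets, one for each
  parameter. Intersecting them with the prevalent fibre keeps them non-shy because shy sets are
  closed under union, for which the witnesses are convolved (\<open>borel_shy_Un\<close>).
\<close>

section \<open>Shy sets in topological groups\<close>

lemma borel_measurable_add_if_continuous_minus_add:
  assumes cont: "continuous_on UNIV (\<lambda>(x::'g::{second_countable_topology, group_add}, y). - x + y)"
  shows "(\<lambda>(x::'g, y). x + y) \<in> borel_measurable (borel \<Otimes>\<^sub>M borel)"
proof -
  have *: "continuous_on UNIV (\<lambda>z. - a z + b z)"
    if "continuous_on UNIV a" "continuous_on UNIV b" for a b :: "'g \<times> 'g \<Rightarrow> 'g"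
    using continuous_on_compose2[OF cont continuous_on_Pair[OF that]] by simp
  have "continuous_on UNIV (\<lambda>z::'g \<times> 'g. - (- fst z + 0) + snd z)"
    by (intro * continuous_on_fst continuous_on_snd continuous_on_id continuous_on_const)
  then have "(\<lambda>(x::'g, y). x + y) \<in> borel_measurable borel"
    by (intro borel_measurable_continuous_onI) (simp add: split_def)
  then show ?thesis
    by (simp add: borel_prod)
qed

text \<open>
  The convolution of the witnesses for the two sets is a witness for both: conditioning on one
  factor turns a two-sided translate of \<open>X\<close> or \<open>Y\<close> into another translate of the same set, which
  is null for the other factor.
\<close>

lemma borel_shy_Un:
  fixes X Y :: "'g::{second_countable_topology, group_add} set"
  assumes cont: "continuous_on UNIV (\<lambda>(x::'g, y). - x + y)"
    and X: "borel_shy X" and Y: "borel_shy Y"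
  shows "borel_shy (X \<union> Y)"
proof -
  let ?tr = "\<lambda>f g. (`) (\<lambda>x::'g. f + x + g)"
  obtain M where M: "borel_prob_measure M" "\<And>f g. ?tr f g X \<in> null_sets M"
    using X unfolding borel_shy_def by blast
  obtain N where N: "borel_prob_measure N" "\<And>f g. ?tr f g Y \<in> null_sets N"
    using Y unfolding borel_shy_def by blast
  interpret M: prob_space M using M(1) by (simp add: borel_prob_measure_def)
  interpret N: prob_space N using N(1) by (simp add: borel_prob_measure_def)
  interpret P: pair_prob_space M N ..
  have sM: "sets M = sets borel" and sN: "sets N = sets borel"
    using M(1) N(1) by (simp_all add: borel_prob_measure_def)
  have spM: "space M = UNIV" and spN: "space N = UNIV"
    using sM sN sets_eq_imp_space_eq space_borel by metis+
  let ?add = "\<lambda>(x::'g, y). x + y"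
  have add [measurable]: "?add \<in> borel_measurable (M \<Otimes>\<^sub>M N)"
    using borel_measurable_add_if_continuous_minus_add[OF cont]
    by (subst measurable_cong_sets[OF sets_pair_measure_cong[OF sM sN] refl])
  define C where "C = distr (M \<Otimes>\<^sub>M N) borel ?add"
  have "prob_space C"
    unfolding C_def by (rule P.prob_space_distr[OF add])
  then have C: "borel_prob_measure C"
    by (simp add: borel_prob_measure_def C_def)
  have tX: "?tr f g X \<in> null_sets C" for f g
  proof -
    have b: "?tr f g X \<in> sets borel"
      using M(2) sM by blast
    have s: "?add -` ?tr f g X \<inter> space (M \<Otimes>\<^sub>M N) \<in> sets (M \<Otimes>\<^sub>M N)"
      using measurable_sets[OF add b] .
    have "(\<lambda>x. (x, y)) -` (?add -` ?tr f g X \<inter> space (M \<Otimes>\<^sub>M N)) = ?tr f (g - y) X" for y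
    proof -
      have "(x + y = f + z + g) = (x = f + z + (g - y))" for x z
        by (metis add.assoc add_diff_eq eq_diff_eq)
      then show ?thesis
        by (auto simp: space_pair_measure spM spN image_iff)
    qed
    then have "emeasure (M \<Otimes>\<^sub>M N) (?add -` ?tr f g X \<inter> space (M \<Otimes>\<^sub>M N)) = 0"
      using P.emeasure_pair_measure_alt2[OF s] M(2) by (simp add: null_setsD1)
    then show ?thesis
      using b by (auto intro!: null_setsI simp: C_def emeasure_distr[OF add b])
  qed
  have tY: "?tr f g Y \<in> null_sets C" for f g
  proof -
    have b: "?tr f g Y \<in> sets borel"
      using N(2) sN by blast
    have s: "?add -` ?tr f g Y \<inter> space (M \<Otimes>\<^sub>M N) \<in> sets (M \<Otimes>\<^sub>M N)"
      using measurable_sets[OF add b] .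
    have "Pair x -` (?add -` ?tr f g Y \<inter> space (M \<Otimes>\<^sub>M N)) = ?tr (- x + f) g Y" for x
    proof -
      have "(x + y = f + z + g) = (y = - x + f + z + g)" for y z
        by (metis add.assoc add_minus_cancel minus_add_cancel)
      then show ?thesis
        by (auto simp: space_pair_measure spM spN image_iff)
    qed
    then have "emeasure (M \<Otimes>\<^sub>M N) (?add -` ?tr f g Y \<inter> space (M \<Otimes>\<^sub>M N)) = 0"
      using N.emeasure_pair_measure_alt[OF s] N(2) by (simp add: null_setsD1)
    then show ?thesis
      using b by (auto intro!: null_setsI simp: C_def emeasure_distr[OF add b])
  qed
  have "X \<union> Y \<in> sets borel"
    using X Y unfolding borel_shy_def by blast
  moreover have "?tr f g (X \<union> Y) \<in> null_sets C" for f g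
    unfolding image_Un using tX tY by blast
  ultimately show ?thesis
    unfolding borel_shy_def using C by blast
qed

lemma shy_subset: "shy S \<Longrightarrow> R \<subseteq> S \<Longrightarrow> shy R"
  unfolding shy_def by blast

lemma shy_Un:
  fixes R S :: "'g::{second_countable_topology, group_add} set"
  assumes cont: "continuous_on UNIV (\<lambda>(x::'g, y). - x + y)" and "shy R" "shy S"
  shows "shy (R \<union> S)"
  using assms(2,3) borel_shy_Un[OF cont] unfolding shy_def by (meson Un_mono)

lemma not_shy_Int_prevalent:
  fixes R S :: "'g::{second_countable_topology, group_add} set"
  assumes "continuous_on UNIV (\<lambda>(x::'g, y). - x + y)" and "\<not> shy S" and "prevalent R"
  shows "\<not> shy (R \<inter> S)"
proof
  assume "shy (R \<inter> S)"
  with assms have "shy (R \<inter> S \<union> - R)"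
    unfolding prevalent_def by (intro shy_Un)
  then have "shy S"
    by (rule shy_subset) blast
  with assms show False by simp
qed

text \<open>
  By inner regularity a probability measure that vanishes on all compact sets would be zero;
  a witness of shyness of \<open>S\<close> vanishes on every compact set that has a translate inside \<open>S\<close>.
\<close>

lemma not_shy_if_catches_compact:
  fixes S :: "'g::{polish_space, group_add} set"
  assumes catch: "\<And>K. compact K \<Longrightarrow> \<exists>h. (+) h ` K \<subseteq> S"
  shows "\<not> shy S"
proof
  assume "shy S"
  then obtain X M where X: "S \<subseteq> X" and M: "borel_prob_measure M"
    and null: "\<And>f g. (\<lambda>x. f + x + g) ` X \<in> null_sets M"
    unfolding shy_def borel_shy_def by blast
  interpret prob_space M using M by (simp add: borel_prob_measure_def)
  have sM: "sets M = sets borel"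
    using M by (simp add: borel_prob_measure_def)
  have "emeasure M K = 0" if "compact K" for K
  proof -
    obtain h where h: "(+) h ` K \<subseteq> S"
      using catch[OF \<open>compact K\<close>] by blast
    have "K \<subseteq> (\<lambda>x. - h + x + 0) ` X"
    proof
      fix k assume "k \<in> K"
      then have "h + k \<in> X" using h X by blast
      moreover have "k = - h + (h + k) + 0" by simp
      ultimately show "k \<in> (\<lambda>x. - h + x + 0) ` X" by blast
    qed
    moreover have "K \<in> sets M"
      using sM \<open>compact K\<close> by (simp add: borel_compact)
    ultimately show ?thesis
      using null null_sets_subset by blast
  qed
  then have "emeasure M UNIV = 0"
    using inner_regular[OF sM, of UNIV] emeasure_finite by (simp add: SUP_constant bot_ennreal)
  then show False
    using emeasure_space_1 sets_eq_imp_space_eq[OF sM] by simp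
qed

section \<open>Disjoint families and finite measures\<close>

lemma uncountable_UNIV_nat_set: "uncountable (UNIV :: nat set set)"
proof
  assume "countable (UNIV :: nat set set)"
  then have "range (from_nat_into (UNIV :: nat set set)) = UNIV"
    by (intro range_from_nat_into) auto
  then show False
    using Cantors_theorem[of "UNIV :: nat set"] by auto
qed

lemma measurable_singleton_algebraI:
  assumes "\<And>x. x \<in> space M \<Longrightarrow> f x \<in> \<Theta>"
    and "\<And>\<theta>. \<theta> \<in> \<Theta> \<Longrightarrow> f -` {\<theta>} \<inter> space M \<in> sets M"
  shows "f \<in> M \<rightarrow>\<^sub>M singleton_algebra \<Theta>"
  unfolding singleton_algebra_def
  using assms by (intro measurable_measure_of) auto

text \<open>
  The measures of disjoint sets are summable, so only countably many of them are nonzero.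
\<close>

lemma exists_null_set_of_uncountable_disjoint_family:
  assumes "finite_measure M" and unc: "uncountable (UNIV :: 'i set)"
    and F: "\<And>i::'i. F i \<in> sets M" and disj: "\<And>i j. i \<noteq> j \<Longrightarrow> F i \<inter> F j = {}"
  shows "\<exists>i. F i \<in> null_sets M"
proof -
  interpret finite_measure M by fact
  have sum_le: "(\<Sum>i\<in>S. measure M (F i)) \<le> measure M (space M)" if "finite S" for S
  proof -
    have "(\<Sum>i\<in>S. measure M (F i)) = measure M (\<Union>i\<in>S. F i)"
      using that F disj
      by (intro finite_measure_finite_Union[symmetric]) (auto simp: disjoint_family_on_def)
    then show ?thesis
      by (simp add: bounded_measure)
  qed
  then have "bdd_above (sum (\<lambda>i. measure M (F i)) ` {S. S \<subseteq> UNIV \<and> finite S})"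
    by (intro bdd_aboveI[of _ "measure M (space M)"]) auto
  then have "(\<lambda>i. measure M (F i)) summable_on UNIV"
    by (intro nonneg_bdd_above_summable_on) auto
  then have "countable {i. measure M (F i) \<noteq> 0}"
    using summable_countable_real by fastforce
  then obtain i where "measure M (F i) = 0"
    using unc countable_subset[of UNIV "{i. measure M (F i) \<noteq> 0}"] by blast
  then show ?thesis
    using F by (auto intro!: exI[of _ i] null_setsI simp: emeasure_eq_measure)
qed

section \<open>A tree of translates\<close>

text \<open>
  Here \<open>q\<close> enumerates a dense set, whose finite pieces \<open>{q i | i \<le> k}\<close> approximate compact sets,
  \<open>g n k\<close> is the element that translates the \<open>k\<close>-th finite piece at stage \<open>n\<close>, and \<open>r n\<close> is
  the precision of stage \<open>n\<close>. Translates of different pieces at stage \<open>n\<close> are separated by more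
  than twice the precision, while all later translations together move points by at most half
  of it.
\<close>

locale separated_translates =
  fixes q :: "nat \<Rightarrow> 'g::{polish_space, group_add}" and g :: "nat \<Rightarrow> nat \<Rightarrow> 'g" and r :: "nat \<Rightarrow> real"
  assumes invariant: "dist (f + h\<^sub>1 + h) (f + h\<^sub>2 + h) = dist h\<^sub>1 (h\<^sub>2 :: 'g)"
    and dense: "\<And>U. open U \<Longrightarrow> U \<noteq> {} \<Longrightarrow> \<exists>i. q i \<in> U"
    and r_pos: "r n > 0" and r_Suc: "r (Suc n) \<le> r n / 2"
    and separated: "k \<noteq> l \<Longrightarrow> i \<le> k \<Longrightarrow> j \<le> l \<Longrightarrow> 2 * r n < dist (g n k + q i) (g n l + q j)"
    and small: "dist 0 (g (Suc n) k) \<le> r n / 4"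
begin

lemma dist_add_left: "dist (f + h\<^sub>1) (f + h\<^sub>2) = dist h\<^sub>1 (h\<^sub>2 :: 'g)"
  using invariant[of f h\<^sub>1 0 h\<^sub>2] by simp

lemma dist_add_right: "dist (h\<^sub>1 + h) (h\<^sub>2 + h) = dist h\<^sub>1 (h\<^sub>2 :: 'g)"
  using invariant[of 0 h\<^sub>1 h h\<^sub>2] by simp

primrec partial :: "(nat \<Rightarrow> nat) \<Rightarrow> nat \<Rightarrow> 'g" where
  "partial u 0 = 0"
| "partial u (Suc n) = partial u n + g n (u n)"

text \<open>
  The stage-\<open>n\<close> approximation to membership in the translate coded by \<open>u\<close>. The bound \<open>i \<le> u n\<close>
  makes \<open>u n\<close> carry two kinds of information: the choice of the translating element, and an upper
  bound for the finite piece that is needed to approximate a compact set.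
\<close>

definition near :: "(nat \<Rightarrow> nat) \<Rightarrow> nat \<Rightarrow> 'g \<Rightarrow> bool" where
  "near u n p \<longleftrightarrow> (\<exists>i\<le>u n. dist (partial u (Suc n) + q i) p \<le> r n)"

definition branch_set :: "(nat \<Rightarrow> nat set) \<Rightarrow> 'g set" where
  "branch_set B = {p. \<exists>u. \<forall>n. u n \<in> B n \<and> near u n p}"

lemma partial_cong: "(\<And>m. m < n \<Longrightarrow> u m = v m) \<Longrightarrow> partial u n = partial v n"
  by (induction n) auto

lemma near_cong: "(\<And>m. m \<le> n \<Longrightarrow> u m = v m) \<Longrightarrow> near u n p = near v n p"
  using partial_cong[of "Suc n" u v] unfolding near_def by auto

text \<open>
  A point determines its code: once the earlier entries agree, the accumulated translation cancels
  by invariance, and the separation at stage \<open>n\<close> exceeds twice the precision.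
\<close>

lemma near_unique:
  assumes "\<And>m. m \<le> n \<Longrightarrow> near u m p" "\<And>m. m \<le> n \<Longrightarrow> near v m p"
  shows "u n = v n"
  using assms
proof (induction n rule: less_induct)
  case (less n)
  then have eq: "partial u n = partial v n"
    by (intro partial_cong) auto
  obtain i where i: "i \<le> u n" "dist (partial u (Suc n) + q i) p \<le> r n"
    using less.prems(1)[of n] unfolding near_def by auto
  obtain j where j: "j \<le> v n" "dist (partial v (Suc n) + q j) p \<le> r n"
    using less.prems(2)[of n] unfolding near_def by auto
  have "dist (g n (u n) + q i) (g n (v n) + q j) =
      dist (partial u (Suc n) + q i) (partial v (Suc n) + q j)"
    by (simp add: eq add.assoc dist_add_left)
  also have "\<dots> \<le> 2 * r n"
    using dist_triangle2[of "partial u (Suc n) + q i" "partial v (Suc n) + q j" p] i j by simp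
  finally show ?case
    using separated[of "u n" "v n" i j n] i j by force
qed

lemma branch_set_mono: "(\<And>n. B n \<subseteq> C n) \<Longrightarrow> branch_set B \<subseteq> branch_set C"
  unfolding branch_set_def by blast

lemma branch_set_disjoint:
  assumes "B n \<inter> C n = {}"
  shows "branch_set B \<inter> branch_set C = {}"
proof -
  have False if p: "p \<in> branch_set B" "p \<in> branch_set C" for p
  proof -
    obtain u v where "\<And>n. u n \<in> B n \<and> near u n p" "\<And>n. v n \<in> C n \<and> near v n p"
      using p unfolding branch_set_def by blast
    moreover from this have "u n = v n"
      by (intro near_unique) auto
    ultimately show False
      using assms by (metis disjoint_iff)
  qed
  then show ?thesis by blast
qed

lemma near_borel: "{p. near u n p} \<in> sets borel"
proof -
  have "{p. near u n p} = (\<Union>i\<in>{..u n}. cball (partial u (Suc n) + q i) (r n))"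
    by (auto simp: near_def)
  then show ?thesis by auto
qed

text \<open>
  The quantifier over sequences \<open>u\<close> makes \<open>branch_set B\<close> a projection, which a priori is only
  analytic. Since codes are unique, the finite codes that fit a point cohere, and the quantifier can
  be replaced by one over finite codes of each length, that is, by countable unions.
\<close>

lemma branch_set_borel: "branch_set B \<in> sets borel"
proof -
  define A where "A N s = {p. \<forall>n<N. near ((!) s) n p}" for N and s :: "nat list"
  define W where "W N = {s. length s = N \<and> (\<forall>n<N. s ! n \<in> B n)}" for N
  have "branch_set B = (\<Inter>N. \<Union>s\<in>W N. A N s)"
  proof
    show "branch_set B \<subseteq> (\<Inter>N. \<Union>s\<in>W N. A N s)"
    proof
      fix p assume "p \<in> branch_set B"
      then obtain u where u: "\<And>n. u n \<in> B n" "\<And>n. near u n p"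
        unfolding branch_set_def by blast
      have "map u [0..<N] \<in> W N \<and> p \<in> A N (map u [0..<N])" for N
      proof -
        have "near ((!) (map u [0..<N])) n p" if "n < N" for n
          using u(2)[of n] that near_cong[of n "(!) (map u [0..<N])" u p] by simp
        then show ?thesis
          using u(1) by (auto simp: W_def A_def)
      qed
      then show "p \<in> (\<Inter>N. \<Union>s\<in>W N. A N s)" by blast
    qed
  next
    show "(\<Inter>N. \<Union>s\<in>W N. A N s) \<subseteq> branch_set B"
    proof
      fix p assume "p \<in> (\<Inter>N. \<Union>s\<in>W N. A N s)"
      then have "\<forall>N. \<exists>s. s \<in> W N \<and> p \<in> A N s" by blast
      then obtain s where s: "\<And>N. s N \<in> W N" "\<And>N. p \<in> A N (s N)" by metis
      define u where "u n = s (Suc n) ! n" for n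
      have eq: "s (Suc n) ! m = u m" if "m \<le> n" for m n
        unfolding u_def using that s(2) by (intro near_unique[of m _ p]) (auto simp: A_def)
      have "near u n p" for n
        using s(2)[of "Suc n"] near_cong[of n "(!) (s (Suc n))" u p] eq by (auto simp: A_def)
      moreover have "u n \<in> B n" for n
        using s(1)[of "Suc n"] by (auto simp: W_def u_def)
      ultimately show "p \<in> branch_set B"
        unfolding branch_set_def by blast
    qed
  qed
  moreover have "A N s \<in> sets borel" for N s
  proof -
    have "A N s = (\<Inter>n\<in>{..<N}. {p. near ((!) s) n p})"
      by (auto simp: A_def)
    then show ?thesis
      using near_borel by (cases "N = 0") (auto intro!: sets.finite_INT simp del: Collect_ball_eq)
  qed
  ultimately show ?thesis
    by (auto intro!: sets.countable_INT sets.countable_UN')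
qed

text \<open>
  The tail of the series of translations after stage \<open>n\<close> stays below half of the precision \<open>r n\<close>,
  leaving the other half for the approximation of a compact set.
\<close>

lemma partial_convergent:
  obtains h where "\<And>n. dist (partial u (Suc n)) h \<le> r n / 2"
proof -
  \<comment> \<open>Subtracting \<open>r (n + m) / 2\<close> lets the induction absorb the next step, which is at most
    \<open>r (n + m) / 4\<close>.\<close>
  have tail: "dist (partial u (Suc n)) (partial u (Suc (n + m))) \<le> r n / 2 - r (n + m) / 2" for n m
  proof (induction m)
    case (Suc m)
    have "dist (partial u (Suc (n + m))) (partial u (Suc (n + Suc m))) \<le> r (n + m) / 4"
      using small[of "n + m" "u (Suc (n + m))"]
        dist_add_left[of "partial u (Suc (n + m))" 0 "g (Suc (n + m)) (u (Suc (n + m)))"]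
      by simp
    then show ?case
      using dist_triangle[of "partial u (Suc n)" "partial u (Suc (n + Suc m))" "partial u (Suc (n + m))"]
        Suc r_Suc[of "n + m"] by simp
  qed simp
  then have tail': "dist (partial u (Suc n)) (partial u (Suc (n + m))) \<le> r n / 2" for n m
    using r_pos[of "n + m"] tail[of n m] by linarith
  have r_le: "r n \<le> r 0 * (1/2) ^ n" for n
    by (induction n) (use r_Suc in \<open>auto intro: order_trans\<close>)
  have "Cauchy (\<lambda>n. partial u (Suc n))"
  proof (rule metric_CauchyI)
    fix e :: real assume "e > 0"
    moreover have "(\<lambda>n. r 0 * (1/2) ^ n) \<longlonglongrightarrow> r 0 * 0"
      by (intro tendsto_mult tendsto_const LIMSEQ_power_zero) simp
    ultimately have "\<forall>\<^sub>F n in sequentially. r 0 * (1/2) ^ n < e"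
      by (intro order_tendstoD) auto
    then obtain n where "r 0 * (1/2) ^ n < e"
      by (auto simp: eventually_sequentially)
    then have n: "r n < e" using r_le[of n] by linarith
    have "dist (partial u (Suc a)) (partial u (Suc b)) < e" if "n \<le> a" "n \<le> b" for a b
      using tail'[of n "a - n"] tail'[of n "b - n"] that n
        dist_triangle3[of "partial u (Suc a)" "partial u (Suc b)" "partial u (Suc n)"] by simp
    then show "\<exists>M. \<forall>m\<ge>M. \<forall>k\<ge>M. dist (partial u (Suc m)) (partial u (Suc k)) < e" by blast
  qed
  then obtain h where h: "(\<lambda>n. partial u (Suc n)) \<longlonglongrightarrow> h"
    using Cauchy_convergent convergent_def by blast
  have "dist (partial u (Suc n)) h \<le> r n / 2" for n
  proof (rule Lim_bounded)
    show "(\<lambda>k. dist (partial u (Suc n)) (partial u (Suc k))) \<longlonglongrightarrow> dist (partial u (Suc n)) h"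
      by (intro tendsto_dist tendsto_const h)
    show "\<forall>k\<ge>n. dist (partial u (Suc n)) (partial u (Suc k)) \<le> r n / 2"
      using tail' by (metis le_add_diff_inverse)
  qed
  then show ?thesis using that by blast
qed

text \<open>
  For a compact set \<open>K\<close> the entry \<open>u n\<close> is chosen in the infinite set \<open>B n\<close> so large that the
  points \<open>q i\<close> with \<open>i \<le> u n\<close> approximate \<open>K\<close> up to \<open>r n / 2\<close>. The limit of the accumulated
  translations then moves \<open>K\<close> into the branch set.
\<close>

lemma branch_set_catches_compact:
  assumes B: "\<And>n. infinite (B n)" and K: "compact K"
  shows "\<exists>h. (+) h ` K \<subseteq> branch_set B"
proof -
  have "\<exists>k\<in>B n. \<forall>y\<in>K. \<exists>i\<le>k. dist (q i) y \<le> r n / 2" for n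
  proof -
    have "K \<subseteq> (\<Union>i. ball (q i) (r n / 2))"
    proof
      fix y
      obtain i where "q i \<in> ball y (r n / 2)"
        using dense[of "ball y (r n / 2)"] r_pos[of n] by auto
      then show "y \<in> (\<Union>i. ball (q i) (r n / 2))"
        by (auto simp: dist_commute)
    qed
    then obtain I where I: "finite I" "K \<subseteq> (\<Union>i\<in>I. ball (q i) (r n / 2))"
      using compactE_image[OF K, of UNIV "\<lambda>i. ball (q i) (r n / 2)"] by auto
    obtain m where m: "\<And>i. i \<in> I \<Longrightarrow> i \<le> m"
      using \<open>finite I\<close> finite_nat_set_iff_bounded_le by auto
    obtain k where "k \<in> B n" "m < k"
      using B[of n] infinite_nat_iff_unbounded by blast
    have "\<exists>i\<le>k. dist (q i) y \<le> r n / 2" if "y \<in> K" for y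
    proof -
      obtain i where "i \<in> I" "dist (q i) y < r n / 2"
        using I(2) \<open>y \<in> K\<close> by auto
      then show ?thesis
        using m[of i] \<open>m < k\<close> by (intro exI[of _ i]) simp
    qed
    then show ?thesis
      using \<open>k \<in> B n\<close> by blast
  qed
  then obtain u where u: "\<And>n. u n \<in> B n" "\<And>n y. y \<in> K \<Longrightarrow> \<exists>i\<le>u n. dist (q i) y \<le> r n / 2"
    by metis
  obtain h where h: "\<And>n. dist (partial u (Suc n)) h \<le> r n / 2"
    using partial_convergent by blast
  have "near u n (h + y)" if "y \<in> K" for y n
  proof -
    obtain i where i: "i \<le> u n" "dist (q i) y \<le> r n / 2"
      using u(2) \<open>y \<in> K\<close> by blast
    have "dist (partial u (Suc n) + q i) (h + y) \<le>
        dist (partial u (Suc n) + q i) (partial u (Suc n) + y) + dist (partial u (Suc n) + y) (h + y)"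
      by (rule dist_triangle)
    also have "\<dots> \<le> r n"
      using i h[of n] by (simp only: dist_add_left dist_add_right)
    finally show ?thesis
      unfolding near_def using i by blast
  qed
  then show ?thesis
    unfolding branch_set_def using u(1) by blast
qed

end

section \<open>Separation from the failure of local compactness\<close>

lemma not_compact_cball:
  fixes e :: real
  assumes invariant: "\<And>f g h\<^sub>1 h\<^sub>2 :: 'g::{polish_space, group_add}. dist (f + h\<^sub>1 + g) (f + h\<^sub>2 + g) = dist h\<^sub>1 h\<^sub>2"
    and nlc: "\<not> locally_compact_space (euclidean :: 'g::{polish_space, group_add} topology)" and "e > 0"
  shows "\<not> compact (cball (0::'g) e)"
proof
  assume c: "compact (cball (0::'g) e)"
  have "\<exists>U K. open U \<and> compact K \<and> x \<in> U \<and> U \<subseteq> K" for x :: 'g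
  proof -
    have d: "dist (x + a) (x + b) = dist a b" for a b
      using invariant[of x a 0 b] by simp
    have "continuous_on (cball 0 e) ((+) x)"
      unfolding continuous_on_iff by (metis d)
    then have "compact ((+) x ` cball 0 e)"
      using c by (rule compact_continuous_image)
    moreover have "ball x e \<subseteq> (+) x ` cball 0 e"
    proof
      fix y assume "y \<in> ball x e"
      then have "- x + y \<in> cball 0 e"
        using d[of 0 "- x + y"] by simp
      then show "y \<in> (+) x ` cball 0 e"
        by (intro image_eqI[of _ _ "- x + y"]) simp_all
    qed
    ultimately show ?thesis
      using \<open>e > 0\<close> by (intro exI[of _ "ball x e"] exI[of _ "(+) x ` cball 0 e"]) simp
  qed
  then have "locally_compact_space (euclidean :: 'g topology)"
    unfolding locally_compact_space_def by simp
  with nlc show False ..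
qed

text \<open>
  The elements \<open>g k\<close> are chosen one after the other. As the ball is not totally bounded,
  it cannot be covered by \<open>d\<close>-balls around the finitely many points \<open>g l + q j - q i\<close> that have to be
  avoided, and right invariance translates avoidance of these points into the required separation.
\<close>

lemma exists_separated_translates:
  fixes q :: "nat \<Rightarrow> 'g::{polish_space, group_add}" and e :: real
  assumes invariant: "\<And>f g h\<^sub>1 h\<^sub>2 :: 'g. dist (f + h\<^sub>1 + g) (f + h\<^sub>2 + g) = dist h\<^sub>1 h\<^sub>2"
    and nlc: "\<not> locally_compact_space (euclidean :: 'g::{polish_space, group_add} topology)" and "e > 0"
  shows "\<exists>d>0. \<exists>g. (\<forall>k. dist 0 (g k) \<le> e) \<and>
    (\<forall>k l i j. k \<noteq> l \<longrightarrow> i \<le> k \<longrightarrow> j \<le> l \<longrightarrow> d \<le> dist (g k + q i) (g l + q j))"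
proof -
  have "\<not> (\<forall>d>0. \<exists>C. finite C \<and> cball (0::'g) e \<subseteq> (\<Union>c\<in>C. ball c d))"
    using not_compact_cball[OF invariant nlc \<open>e > 0\<close>]
    unfolding compact_eq_totally_bounded complete_eq_closed by simp
  then obtain d where d: "d > 0" "\<nexists>C. finite C \<and> cball (0::'g) e \<subseteq> (\<Union>c\<in>C. ball c d)"
    unfolding not_all not_imp by (elim exE conjE)
  define P where "P g k x \<longleftrightarrow> dist 0 x \<le> e \<and>
    (\<forall>l<k. \<forall>i\<le>k. \<forall>j\<le>l. d \<le> dist (x + q i) (g l + q j))" for g k x
  have "\<exists>g. \<forall>k. P g k (g k)"
  proof (rule dependent_wellorder_choice)
    fix g k
    define C where "C = (\<lambda>(l, i, j). g l + q j - q i) ` ({..<k} \<times> {..k} \<times> {..k})"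
    have "finite C"
      by (simp add: C_def)
    then have "\<not> cball 0 e \<subseteq> (\<Union>c\<in>C. ball c d)"
      using d(2) by blast
    then obtain x where x: "dist 0 x \<le> e" "\<And>c. c \<in> C \<Longrightarrow> d \<le> dist c x"
      by (auto simp: subset_iff not_less)
    have "d \<le> dist (x + q i) (g l + q j)" if "l < k" "i \<le> k" "j \<le> l" for l i j
    proof -
      have "g l + q j - q i \<in> C"
        unfolding C_def using that by (intro image_eqI[of _ _ "(l, i, j)"]) auto
      then have "d \<le> dist (g l + q j - q i) x"
        using x(2) by blast
      also have "\<dots> = dist (x + q i) (g l + q j)"
        using invariant[of 0 "g l + q j - q i" "q i" x] by (simp add: dist_commute)
      finally show ?thesis .
    qed
    with x show "\<exists>x. P g k x"
      unfolding P_def by blast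
  qed (auto simp: P_def)
  then obtain g where g: "\<And>k. P g k (g k)" by blast
  have "d \<le> dist (g k + q i) (g l + q j)" if "k \<noteq> l" "i \<le> k" "j \<le> l" for k l i j
  proof (cases "l < k")
    case True
    then show ?thesis using g[of k] that by (auto simp: P_def)
  next
    case False
    then have "d \<le> dist (g l + q j) (g k + q i)"
      using g[of l] that by (auto simp: P_def)
    then show ?thesis by (simp add: dist_commute)
  qed
  with d(1) g show ?thesis
    unfolding P_def by blast
qed

text \<open>
  The precision of a stage is limited by the separation \<open>D\<close> that its radius \<open>eps n\<close> permits, and
  a quarter of it is the radius of the next stage.
\<close>

lemma exists_separated_translates_at_all_scales:
  assumes invariant: "\<And>f g h\<^sub>1 h\<^sub>2 :: 'g::{polish_space, group_add}. dist (f + h\<^sub>1 + g) (f + h\<^sub>2 + g) = dist h\<^sub>1 h\<^sub>2"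
    and nlc: "\<not> locally_compact_space (euclidean :: 'g::{polish_space, group_add} topology)"
  shows "\<exists>(q :: nat \<Rightarrow> 'g::{polish_space, group_add}) g r. separated_translates q g r"
proof -
  obtain Q :: "'g set" where Q: "countable Q" "\<And>U. open U \<Longrightarrow> U \<noteq> {} \<Longrightarrow> \<exists>d\<in>Q. d \<in> U"
    by (rule countable_dense_setE) blast
  then have "Q \<noteq> {}" using Q(2)[of UNIV] by auto
  define q where "q = from_nat_into Q"
  have dense: "\<exists>i. q i \<in> U" if "open U" "U \<noteq> {}" for U
    using Q that \<open>Q \<noteq> {}\<close> unfolding q_def by (metis from_nat_into_surj)
  obtain D G where D: "\<And>e. e > 0 \<Longrightarrow> D e > 0"
    and G: "\<And>e k. e > 0 \<Longrightarrow> dist 0 (G e k) \<le> e"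
    and sep: "\<And>e k l i j. e > 0 \<Longrightarrow> k \<noteq> l \<Longrightarrow> i \<le> k \<Longrightarrow> j \<le> l \<Longrightarrow>
      D e \<le> dist (G e k + q i) (G e l + q j)"
    using exists_separated_translates[OF invariant nlc, of _ q] by metis
  define tol where "tol e = min e (D e / 3)" for e
  define eps where "eps = rec_nat 1 (\<lambda>_ e. tol e / 4)"
  have eps_Suc: "eps (Suc n) = tol (eps n) / 4" for n
    by (simp add: eps_def)
  have tol: "tol e > 0" "tol e \<le> e" "2 * tol e < D e" if "e > 0" for e
    using D[OF that] that by (auto simp: tol_def min_def)
  have eps: "eps n > 0" for n
    by (induction n) (auto simp: eps_Suc tol, simp add: eps_def)
  have "separated_translates q (\<lambda>n. G (eps n)) (\<lambda>n. tol (eps n))"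
  proof
    show "dist (f + h\<^sub>1 + h) (f + h\<^sub>2 + h) = dist h\<^sub>1 (h\<^sub>2::'g)" for f h\<^sub>1 h\<^sub>2 h
      by (rule invariant)
    show "\<exists>i. q i \<in> U" if "open U" "U \<noteq> {}" for U
      using dense that by blast
    show "0 < tol (eps n)" for n
      using tol eps by blast
    show "tol (eps (Suc n)) \<le> tol (eps n) / 2" for n
      using tol(2)[OF eps[of "Suc n"]] tol(1)[OF eps[of n]] by (simp add: eps_Suc)
    show "2 * tol (eps n) < dist (G (eps n) k + q i) (G (eps n) l + q j)"
      if "k \<noteq> l" "i \<le> k" "j \<le> l" for n k l i j
      using tol(3)[OF eps[of n]] sep[OF eps[of n] that] by linarith
    show "dist 0 (G (eps (Suc n)) k) \<le> tol (eps n) / 4" for n k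
      using G[OF eps[of "Suc n"], of k] by (simp add: eps_Suc)
  qed
  then show ?thesis by blast
qed

text \<open>
  Prescribing the parities of the code at even positions gives \<open>F y\<close>, at all positions \<open>S y x\<close>.
  The second level is there because the first one has to be thinned out to a null set: after
  one \<open>y\<close> is fixed, \<open>x\<close> still ranges over the continuum.
\<close>

lemma exists_two_level_non_shy_family:
  assumes invariant: "\<And>f g h\<^sub>1 h\<^sub>2 :: 'g::{polish_space, group_add}. dist (f + h\<^sub>1 + g) (f + h\<^sub>2 + g) = dist h\<^sub>1 h\<^sub>2"
    and nlc: "\<not> locally_compact_space (euclidean :: 'g::{polish_space, group_add} topology)"
  shows "\<exists>(F :: nat set \<Rightarrow> 'g::{polish_space, group_add} set) S.
    (\<forall>y. F y \<in> sets borel) \<and> (\<forall>y y'. y \<noteq> y' \<longrightarrow> F y \<inter> F y' = {}) \<and>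
    (\<forall>y. F y = (\<Union>x::nat set. S y x)) \<and>
    (\<forall>y x. S y x \<in> sets borel \<and> \<not> shy (S y x)) \<and>
    (\<forall>y x x'. x \<noteq> x' \<longrightarrow> S y x \<inter> S y x' = {})"
proof -
  obtain q :: "nat \<Rightarrow> 'g" and g r where "separated_translates q g r"
    using exists_separated_translates_at_all_scales[OF invariant nlc] by blast
  then interpret separated_translates q g r .
  define E where "E z n = {k::nat. even k \<longleftrightarrow> n \<in> z}" for z and n :: nat
  have E: "E z n \<inter> E z' n = {}" if "(n \<in> z) \<noteq> (n \<in> z')" for z z' n
    using that by (auto simp: E_def)
  have inf: "infinite (E z n)" for z n
    unfolding infinite_nat_iff_unbounded
  proof
    fix m :: nat
    have "2 * m + 2 \<in> E z n \<or> 2 * m + 1 \<in> E z n"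
      by (auto simp: E_def)
    then show "\<exists>k>m. k \<in> E z n"
      by (elim disjE) (auto intro: exI[of _ "2 * m + 2"] exI[of _ "2 * m + 1"])
  qed
  define A where "A y n = (if even n then E y (n div 2) else UNIV)" for y n
  define B where "B y x n = (if even n then E y (n div 2) else E x (n div 2))" for y x n
  show ?thesis
  proof (intro exI[of _ "\<lambda>y. branch_set (A y)"] exI[of _ "\<lambda>y x. branch_set (B y x)"]
      conjI allI impI)
    show "branch_set (A y) \<inter> branch_set (A y') = {}" if "y \<noteq> y'" for y y'
    proof -
      obtain n where "(n \<in> y) \<noteq> (n \<in> y')" using \<open>y \<noteq> y'\<close> by blast
      then show ?thesis
        using E by (intro branch_set_disjoint[of _ "2 * n"]) (simp add: A_def)
    qed
    show "branch_set (B y x) \<inter> branch_set (B y x') = {}" if "x \<noteq> x'" for y x x'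
    proof -
      obtain n where "(n \<in> x) \<noteq> (n \<in> x')" using \<open>x \<noteq> x'\<close> by blast
      then show ?thesis
        using E by (intro branch_set_disjoint[of _ "2 * n + 1"]) (simp add: B_def)
    qed
    show "branch_set (A y) = (\<Union>x. branch_set (B y x))" for y
    proof
      show "(\<Union>x. branch_set (B y x)) \<subseteq> branch_set (A y)"
        by (intro UN_least branch_set_mono) (simp add: A_def B_def)
      show "branch_set (A y) \<subseteq> (\<Union>x. branch_set (B y x))"
      proof
        fix p assume "p \<in> branch_set (A y)"
        then obtain u where u: "\<And>n. u n \<in> A y n" "\<And>n. near u n p"
          unfolding branch_set_def by blast
        have "u n \<in> B y {m. even (u (2 * m + 1))} n" for n
          using u(1)[of n] by (auto simp: A_def B_def E_def elim!: oddE)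
        then show "p \<in> (\<Union>x. branch_set (B y x))"
          unfolding branch_set_def using u(2) by blast
      qed
    qed
    show "\<not> shy (branch_set (B y x))" for y x
      using inf by (intro not_shy_if_catches_compact branch_set_catches_compact) (simp_all add: B_def)
  qed (rule branch_set_borel)+
qed

section \<open>Redistributing the prevalent fibre\<close>

theorem theorem6p21:
  fixes \<Theta> :: "'p set"
    and \<mu> :: "'p \<Rightarrow> 'g::{polish_space, group_add} measure"
    and T :: "'g \<Rightarrow> 'p"
    and \<theta>\<^sub>0 :: 'p
  assumes invariant_metric: "\<And>f g h\<^sub>1 h\<^sub>2 :: 'g. dist (f + h\<^sub>1 + g) (f + h\<^sub>2 + g) = dist h\<^sub>1 h\<^sub>2"
    and continuous_group: "continuous_on UNIV (\<lambda>(x::'g, y). - x + y)"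
    and not_locally_compact: "\<not> locally_compact_space (euclidean :: 'g topology)"
    and card_continuum: "\<Theta> \<approx> (UNIV :: nat set set)"
    and borel_prob: "\<And>\<theta>. \<theta> \<in> \<Theta> \<Longrightarrow> borel_prob_measure (\<mu> \<theta>)"
    and consistent: "consistent_estimate \<Theta> \<mu> T"
    and prevalent_fibre: "\<theta>\<^sub>0 \<in> \<Theta>" "prevalent (T -` {\<theta>\<^sub>0})"
  shows "\<exists>T'. objective_consistent_estimate \<Theta> \<mu> T'"
proof -
  obtain F :: "nat set \<Rightarrow> 'g set" and S :: "nat set \<Rightarrow> nat set \<Rightarrow> 'g set"
    where F: "\<forall>y. F y \<in> sets borel" "\<forall>y y'. y \<noteq> y' \<longrightarrow> F y \<inter> F y' = {}"
      and F_UN: "\<forall>y. F y = (\<Union>x. S y x)"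
      and S: "\<forall>y x. S y x \<in> sets borel \<and> \<not> shy (S y x)"
      and S_disj: "\<forall>y x x'. x \<noteq> x' \<longrightarrow> S y x \<inter> S y x' = {}"
    using exists_two_level_non_shy_family[OF invariant_metric not_locally_compact]
    by (elim exE conjE) (rule that)
  interpret \<mu>\<^sub>0: prob_space "\<mu> \<theta>\<^sub>0"
    using borel_prob[OF prevalent_fibre(1)] by (simp add: borel_prob_measure_def)
  have sets_\<mu>: "sets (\<mu> \<theta>) = sets borel" if "\<theta> \<in> \<Theta>" for \<theta>
    using borel_prob[OF that] by (simp add: borel_prob_measure_def)
  have "\<exists>y. F y \<in> null_sets (\<mu> \<theta>\<^sub>0)"
  proof (rule exists_null_set_of_uncountable_disjoint_family)
    show "finite_measure (\<mu> \<theta>\<^sub>0)"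
      by (rule \<mu>\<^sub>0.finite_measure_axioms)
    show "F y \<in> sets (\<mu> \<theta>\<^sub>0)" for y
      using F(1) sets_\<mu>[OF prevalent_fibre(1)] by simp
  qed (use uncountable_UNIV_nat_set F(2) in auto)
  then obtain y where y: "F y \<in> null_sets (\<mu> \<theta>\<^sub>0)" ..
  obtain b where b: "bij_betw b \<Theta> (UNIV :: nat set set)"
    using card_continuum unfolding eqpoll_def by blast
  define V where "V \<theta> = S y (b \<theta>)" for \<theta>
  have V: "V \<theta> \<in> sets borel" "\<not> shy (V \<theta>)" for \<theta>
    using S by (simp_all add: V_def)
  have F_eq: "F y = (\<Union>\<theta>\<in>\<Theta>. V \<theta>)"
    using F_UN[rule_format, of y] bij_betw_imp_surj_on[OF b] unfolding V_def by (metis image_image)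
  have V_disj: "\<theta> = \<theta>'" if "\<theta> \<in> \<Theta>" "\<theta>' \<in> \<Theta>" "p \<in> V \<theta>" "p \<in> V \<theta>'" for \<theta> \<theta>' p
    using that S_disj[rule_format, of "b \<theta>" "b \<theta>'" y] bij_betw_imp_inj_on[OF b]
    unfolding V_def by (meson disjoint_iff inj_onD)
  have T_meas: "T \<in> borel \<rightarrow>\<^sub>M singleton_algebra \<Theta>"
    and T_one: "\<And>\<theta>. \<theta> \<in> \<Theta> \<Longrightarrow> emeasure (\<mu> \<theta>) (T -` {\<theta>}) = 1"
    using consistent by (simp_all add: consistent_estimate_def)
  have space_alg: "space (singleton_algebra \<Theta>) = \<Theta>"
    unfolding singleton_algebra_def by (rule space_measure_of) auto
  have T_in: "T p \<in> \<Theta>" for p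
    using measurable_space[OF T_meas, of p] by (simp add: space_alg)
  have T_borel: "T -` {\<theta>} \<in> sets borel" if "\<theta> \<in> \<Theta>" for \<theta>
    using measurable_sets[OF T_meas, of "{\<theta>}"] that
    by (auto simp: singleton_algebra_def intro!: in_measure_of)
  \<comment> \<open>The part of the prevalent fibre inside \<open>F y\<close> is redistributed completely, with \<open>\<theta>\<^sub>0\<close> receiving
    its share; since \<open>b\<close> is onto, nothing of it is left over, which keeps the fibre of \<open>\<theta>\<^sub>0\<close>
    Borel although uncountably many sets are removed.\<close>
  define T' where "T' p =
    (if T p = \<theta>\<^sub>0 \<and> p \<in> F y then THE \<theta>. \<theta> \<in> \<Theta> \<and> p \<in> V \<theta> else T p)" for p
  have T'_V: "T' p = \<theta>" if "T p = \<theta>\<^sub>0" "\<theta> \<in> \<Theta>" "p \<in> V \<theta>" for p \<theta>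
  proof -
    have "(THE \<theta>. \<theta> \<in> \<Theta> \<and> p \<in> V \<theta>) = \<theta>"
      using that V_disj by blast
    then show ?thesis
      using that F_eq by (auto simp: T'_def)
  qed
  have T'_T: "T' p = T p" if "\<not> (T p = \<theta>\<^sub>0 \<and> p \<in> F y)" for p
    unfolding T'_def using that by (rule if_not_P)
  have T'_in: "T' p \<in> \<Theta>" for p
    using T'_V[of p] T'_T[of p] T_in F_eq by (cases "T p = \<theta>\<^sub>0 \<and> p \<in> F y") auto
  define N where "N = T -` {\<theta>\<^sub>0} \<inter> F y"
  have fibre: "T' -` {\<theta>} = (T -` {\<theta>} - N) \<union> (T -` {\<theta>\<^sub>0} \<inter> V \<theta>)" if "\<theta> \<in> \<Theta>" for \<theta>
  proof (rule set_eqI)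
    fix p
    show "p \<in> T' -` {\<theta>} \<longleftrightarrow> p \<in> (T -` {\<theta>} - N) \<union> (T -` {\<theta>\<^sub>0} \<inter> V \<theta>)"
    proof (cases "p \<in> N")
      case True
      then obtain \<theta>' where \<theta>': "T p = \<theta>\<^sub>0" "\<theta>' \<in> \<Theta>" "p \<in> V \<theta>'"
        by (auto simp: N_def F_eq)
      then have "T' p = \<theta> \<longleftrightarrow> p \<in> V \<theta>"
        using T'_V[OF \<theta>'] V_disj[OF \<open>\<theta>' \<in> \<Theta>\<close> that] by blast
      then show ?thesis
        using True \<theta>'(1) by simp
    next
      case False
      then have "T' p = T p" "\<not> (T p = \<theta>\<^sub>0 \<and> p \<in> V \<theta>)"
        using T'_T that by (auto simp: N_def F_eq)
      then show ?thesis
        using False by auto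
    qed
  qed
  have fibre_borel: "T' -` {\<theta>} \<in> sets borel" if "\<theta> \<in> \<Theta>" for \<theta>
    unfolding fibre[OF that] N_def using T_borel prevalent_fibre(1) that F(1) V(1)
    by (intro sets.Un sets.Diff sets.Int) simp_all
  have big: "\<not> shy (T -` {\<theta>\<^sub>0} \<inter> V \<theta>)" for \<theta>
    using not_shy_Int_prevalent[OF continuous_group V(2) prevalent_fibre(2)] .
  have one: "emeasure (\<mu> \<theta>) (T' -` {\<theta>}) = 1" if \<theta>: "\<theta> \<in> \<Theta>" for \<theta>
  proof -
    interpret prob_space "\<mu> \<theta>"
      using borel_prob[OF \<theta>] by (simp add: borel_prob_measure_def)
    have "emeasure (\<mu> \<theta>) (T -` {\<theta>} - N) = emeasure (\<mu> \<theta>) (T -` {\<theta>})"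
    proof (cases "\<theta> = \<theta>\<^sub>0")
      case True
      then have "T -` {\<theta>} - N = T -` {\<theta>} - F y"
        by (auto simp: N_def)
      then show ?thesis
        using y T_borel[OF \<theta>] sets_\<mu>[OF \<theta>] True by (simp add: emeasure_Diff_null_set)
    next
      case False
      then have "T -` {\<theta>} - N = T -` {\<theta>}"
        by (auto simp: N_def)
      then show ?thesis by simp
    qed
    moreover have "emeasure (\<mu> \<theta>) (T -` {\<theta>} - N) \<le> emeasure (\<mu> \<theta>) (T' -` {\<theta>})"
      using fibre[OF \<theta>] fibre_borel[OF \<theta>] sets_\<mu>[OF \<theta>] by (intro emeasure_mono) auto
    ultimately show ?thesis
      using T_one[OF \<theta>] emeasure_le_1[of "T' -` {\<theta>}"] by simp
  qed
  have ambivalent: "haar_ambivalent (T' -` {\<theta>})" if \<theta>: "\<theta> \<in> \<Theta>" for \<theta>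
  proof -
    obtain \<theta>' where \<theta>': "\<theta>' \<in> \<Theta>" "\<theta>' \<noteq> \<theta>"
    proof -
      \<comment> \<open>Any other parameter serves; the complement of \<open>b \<theta>\<close> is a value of \<open>b\<close> that differs from it.\<close>
      obtain \<theta>' where "\<theta>' \<in> \<Theta>" "b \<theta>' = - b \<theta>"
        using bij_betw_imp_surj_on[OF b] by (metis UNIV_I imageE)
      then show ?thesis using that by force
    qed
    have "T -` {\<theta>\<^sub>0} \<inter> V \<theta>' \<subseteq> - (T' -` {\<theta>})"
      using T'_V \<theta>' by auto
    then have "\<not> prevalent (T' -` {\<theta>})"
      unfolding prevalent_def using big shy_subset by blast
    moreover have "\<not> shy (T' -` {\<theta>})"
      using fibre[OF \<theta>] big shy_subset by blast
    ultimately show ?thesis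
      unfolding haar_ambivalent_def using fibre_borel[OF \<theta>] by blast
  qed
  have "T' \<in> borel \<rightarrow>\<^sub>M singleton_algebra \<Theta>"
    using T'_in fibre_borel by (intro measurable_singleton_algebraI) auto
  then have "objective_consistent_estimate \<Theta> \<mu> T'"
    unfolding objective_consistent_estimate_def consistent_estimate_def
    using one ambivalent by blast
  then show ?thesis by (rule exI[of _ T'])
qed

end
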